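(* Let $d \geq 1$ be an integer, let $\|\cdot\|_*$ be any norm on $\mathbb{R}^d$, and let $E \subseteq \mathbb{R}^d$ be any set. Then for every $x \in \mathbb{R}^d$, $$\dim_H \Delta_x^*(E) \;\geq\; \dim_H E - (d-1),$$ where $\Delta_x^*(E) := \{\|x-y\|_* \in [0,\infty) : y \in E\}$ is the pinned distance set of $E$ at $x$ with respect to $\|\cdot\|_*$.
   Context: $\dim_H$ denotes Hausdorff dimension (with respect to the usual Euclidean metric on $\mathbb{R}^d$ and on $\mathbb{R}$). The set $E$ is arbitrary: no measurability or other regularity is assumed. The pin $x$ is not required to belong to $E$. *)

theory Defs
  imports "HOL-Analysis.Analysis"
begin

text \<open>The \<open>s\<close>-dimensional gauge of a bounded set. The case \<open>s = 0\<close> is separated because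
  \<open>0 powr 0 = 0\<close> in the library, whereas nonempty sets of diameter zero must get gauge \<open>1\<close> there,
  so that the zero-dimensional Hausdorff measure is counting measure.\<close>

definition hausdorff_gauge :: "real \<Rightarrow> 'a::metric_space set \<Rightarrow> ennreal" where
  "hausdorff_gauge s U =
     (if U = {} then 0 else if s = 0 then 1 else ennreal (diameter U powr s))"

text \<open>Finite covers are included, as covering sets may be empty. Boundedness is required
  explicitly, since \<^const>\<open>diameter\<close> has no meaningful value on unbounded sets.\<close>

definition hausdorff_premeasure :: "real \<Rightarrow> real \<Rightarrow> 'a::metric_space set \<Rightarrow> ennreal" where
  "hausdorff_premeasure s \<delta> A =
     (INF U \<in> {U :: nat \<Rightarrow> 'a set. A \<subseteq> (\<Union>i. U i) \<and> (\<forall>i. bounded (U i) \<and> diameter (U i) \<le> \<delta>)}.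
        \<Sum>i. hausdorff_gauge s (U i))"

definition hausdorff_measure :: "real \<Rightarrow> 'a::metric_space set \<Rightarrow> ennreal" where
  "hausdorff_measure s A = (SUP \<delta> \<in> {0<..}. hausdorff_premeasure s \<delta> A)"

text \<open>Extended-real valued, so that the infimum over the empty set is \<open>\<infinity>\<close>; the empty set
  has dimension \<open>0\<close>.\<close>

definition hausdorff_dim :: "'a::metric_space set \<Rightarrow> ereal" where
  "hausdorff_dim A = Inf {ereal s | s. 0 \<le> s \<and> hausdorff_measure s A = 0}"

definition is_norm :: "('a::real_vector \<Rightarrow> real) \<Rightarrow> bool" where
  "is_norm N \<longleftrightarrow>
     (\<forall>v. 0 \<le> N v) \<and>
     (\<forall>v. N v = 0 \<longleftrightarrow> v = 0) \<and>
     (\<forall>c v. N (c *\<^sub>R v) = \<bar>c\<bar> * N v) \<and>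
     (\<forall>v w. N (v + w) \<le> N v + N w)"

definition pinned_distance_set :: "('a::real_vector \<Rightarrow> real) \<Rightarrow> 'a \<Rightarrow> 'a set \<Rightarrow> real set" where
  "pinned_distance_set N x E = {N (x - y) | y. y \<in> E}"

end

theory Submission
  imports Defs
begin

text \<open>
  For \<open>s > 0\<close> a set is \<open>s\<close>-null exactly when its \<open>s\<close>-dimensional content (the premeasure without
  the restriction on diameters) vanishes, and the content is countably subadditive. Cover a bounded
  part of the pinned distance set by sets of diameter at most \<open>r\<^sub>i\<close> with \<open>\<Sum>i. r\<^sub>i powr s\<close> small. The
  points whose distance from \<open>x\<close> lies in the \<open>i\<close>-th set form an annulus of thickness \<open>r\<^sub>i\<close>. Radially
  projecting onto the faces of a cube, on which the direction of a vector depends Lipschitz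
  continuously on its \<open>d - 1\<close> free coordinates, splits it into \<open>O(r\<^sub>i powr (1 - d))\<close> cells of
  diameter \<open>O(r\<^sub>i)\<close>. The contribution of the annulus to the \<open>(s + d - 1)\<close>-content of \<open>E\<close>
  is thus \<open>O(r\<^sub>i powr s)\<close>.
\<close>

section \<open>Hausdorff content and countable subadditivity\<close>

text \<open>The cost is a plain \<open>powr\<close>, which agrees with
  \<open>hausdorff_gauge\<close> for \<open>0 < s\<close>; sets of diameter zero, the empty set
  among them, cost nothing.\<close>

definition hausdorff_content :: "real \<Rightarrow> 'a::metric_space set \<Rightarrow> ennreal" where
  "hausdorff_content s A =
     (INF U \<in> {U :: nat \<Rightarrow> 'a set. A \<subseteq> (\<Union>i. U i) \<and> (\<forall>i. bounded (U i))}.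
        \<Sum>i. ennreal (diameter (U i) powr s))"

lemma hausdorff_content_le:
  assumes "A \<subseteq> (\<Union>i. U i)" "\<And>i. bounded (U i)"
  shows "hausdorff_content s A \<le> (\<Sum>i. ennreal (diameter (U i) powr s))"
  unfolding hausdorff_content_def using assms by (intro INF_lower) auto

lemma hausdorff_content_lessE:
  assumes "hausdorff_content s A < c"
  obtains U where "A \<subseteq> (\<Union>i. U i)" "\<And>i. bounded (U i)"
    "(\<Sum>i. ennreal (diameter (U i) powr s)) < c"
proof -
  have "\<exists>U. A \<subseteq> (\<Union>i. U i) \<and> (\<forall>i. bounded (U i)) \<and> (\<Sum>i. ennreal (diameter (U i) powr s)) < c"
    using assms unfolding hausdorff_content_def INF_less_iff by blast
  then show thesis using that by blast
qed

lemma hausdorff_content_mono: "A \<subseteq> B \<Longrightarrow> hausdorff_content s A \<le> hausdorff_content s B"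
  unfolding hausdorff_content_def by (intro INF_superset_mono) auto

lemma suminf_half_series_ennreal_mult:
  assumes "0 \<le> e"
  shows "(\<Sum>i. ennreal (e * (1/2) ^ Suc i)) = ennreal e"
proof -
  have "(\<lambda>i. e * (1/2) ^ Suc i) sums (e * 1)"
    by (intro sums_mult power_half_series)
  then show ?thesis
    using assms by (intro sums_unique[symmetric] sums_ennreal[THEN iffD2]) auto
qed

lemma hausdorff_content_subadditive:
  fixes A :: "nat \<Rightarrow> 'a::metric_space set"
  shows "hausdorff_content s (\<Union>i. A i) \<le> (\<Sum>i. hausdorff_content s (A i))"
proof (rule ennreal_le_epsilon)
  fix e :: real
  assume fin: "(\<Sum>i. hausdorff_content s (A i)) < top" and e: "0 < e"
  have "\<exists>U. A i \<subseteq> (\<Union>j. U j) \<and> (\<forall>j. bounded (U j)) \<and>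
      (\<Sum>j. ennreal (diameter (U j) powr s)) \<le> hausdorff_content s (A i) + ennreal (e * (1/2) ^ Suc i)" for i
  proof -
    let ?c = "hausdorff_content s (A i)"
    have "?c < top"
      using ennreal_suminf_lessD[OF fin, of i] .
    moreover have "0 < ennreal (e * (1/2) ^ Suc i)" using e by simp
    \<comment> \<open>Adding a positive amount gives a strictly larger value only because
      \<open>?c\<close> is finite; this is what makes a near-optimal cover available.\<close>
    ultimately have "?c < ?c + ennreal (e * (1/2) ^ Suc i)"
      using ennreal_add_left_cancel_less[of ?c 0] by simp
    then show ?thesis
      by (rule hausdorff_content_lessE) (blast intro: less_imp_le)
  qed
  then obtain U where U: "\<And>i. A i \<subseteq> (\<Union>j. U i j)" "\<And>i j. bounded (U i j)"
    "\<And>i. (\<Sum>j. ennreal (diameter (U i j) powr s)) \<le> hausdorff_content s (A i) + ennreal (e * (1/2) ^ Suc i)"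
    by metis
  \<comment> \<open>The covers of all the \<open>A i\<close> are merged into one sequence by
    \<open>prod_decode\<close>, which leaves the total cost equal to the double sum.\<close>
  define V where "V = (\<lambda>(i, j). U i j)"
  have "(\<Union>i. A i) \<subseteq> (\<Union>n. V (prod_decode n))"
  proof clarify
    fix y i assume "y \<in> A i"
    then obtain j where "y \<in> U i j" using U(1) by blast
    then show "y \<in> (\<Union>n. V (prod_decode n))"
      by (intro UN_I[of "prod_encode (i, j)"]) (auto simp: V_def)
  qed
  then have "hausdorff_content s (\<Union>i. A i) \<le> (\<Sum>n. ennreal (diameter (V (prod_decode n)) powr s))"
    by (rule hausdorff_content_le) (auto simp: V_def U split: prod.split)
  also have "\<dots> = (\<Sum>i. \<Sum>j. ennreal (diameter (U i j) powr s))"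
    by (rule suminf_ennreal_2dimen[where f = "\<lambda>p. ennreal (diameter (V p) powr s)"]) (simp add: V_def)
  also have "\<dots> \<le> (\<Sum>i. hausdorff_content s (A i) + ennreal (e * (1/2) ^ Suc i))"
    by (intro suminf_le U(3) summableI)
  also have "\<dots> = (\<Sum>i. hausdorff_content s (A i)) + (\<Sum>i. ennreal (e * (1/2) ^ Suc i))"
    by (intro suminf_add[symmetric] summableI)
  also have "(\<Sum>i. ennreal (e * (1/2) ^ Suc i)) = ennreal e"
    using e by (intro suminf_half_series_ennreal_mult) simp
  finally show "hausdorff_content s (\<Union>i. A i) \<le> (\<Sum>i. hausdorff_content s (A i)) + ennreal e" .
qed

lemma hausdorff_content_finite_cover:
  assumes "finite I" "A \<subseteq> (\<Union>i\<in>I. B i)" "\<And>i. i \<in> I \<Longrightarrow> bounded (B i)"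
    and diam: "\<And>i. i \<in> I \<Longrightarrow> diameter (B i) \<le> D" and "0 < s"
  shows "hausdorff_content s A \<le> ennreal (card I * D powr s)"
proof -
  obtain h where h: "bij_betw h {0..<card I} I"
    using ex_bij_betw_nat_finite[OF \<open>finite I\<close>] by blast
  \<comment> \<open>Padding with empty sets turns the finite family into a sequence at no cost,
    since \<open>diameter {} = 0\<close> and \<open>0 powr s = 0\<close>.\<close>
  define V where "V = (\<lambda>m. if m < card I then B (h m) else {})"
  have hI: "h m \<in> I" if "m < card I" for m
    using h that by (auto simp: bij_betw_def)
  have "A \<subseteq> (\<Union>m. V m)"
  proof
    fix y assume "y \<in> A"
    then obtain i where "i \<in> I" "y \<in> B i" using assms(2) by blast
    then have "i \<in> h ` {0..<card I}" by (simp only: bij_betw_imp_surj_on[OF h])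
    then obtain m where "m < card I" "h m = i" by auto
    then show "y \<in> (\<Union>m. V m)"
      using \<open>y \<in> B i\<close> by (intro UN_I[of m]) (auto simp: V_def)
  qed
  then have "hausdorff_content s A \<le> (\<Sum>m. ennreal (diameter (V m) powr s))"
    by (rule hausdorff_content_le) (auto simp: V_def hI assms(3))
  also have "\<dots> = (\<Sum>m<card I. ennreal (diameter (V m) powr s))"
    by (rule suminf_finite) (auto simp: V_def)
  also have "\<dots> \<le> (\<Sum>m<card I. ennreal (D powr s))"
    using \<open>0 < s\<close>
    by (intro sum_mono ennreal_leI powr_mono2) (auto simp: V_def hI diam assms(3) diameter_ge_0)
  also have "\<dots> = ennreal (card I * D powr s)"
    by (simp add: ennreal_mult ennreal_of_nat_eq_real_of_nat)
  finally show ?thesis .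
qed

section \<open>Null sets of Hausdorff measure\<close>

lemma hausdorff_gauge_pos: "0 < s \<Longrightarrow> hausdorff_gauge s U = ennreal (diameter U powr s)"
  by (simp add: hausdorff_gauge_def)

lemma hausdorff_premeasure_eq_0_of_measure:
  assumes "hausdorff_measure s A = 0" "0 < \<delta>"
  shows "hausdorff_premeasure s \<delta> A = 0"
proof -
  have "hausdorff_premeasure s \<delta> A \<le> hausdorff_measure s A"
    unfolding hausdorff_measure_def using assms(2) by (intro SUP_upper) simp
  then show ?thesis using assms(1) by simp
qed

text \<open>Every nonempty covering set has gauge \<open>1\<close> at exponent \<open>0\<close>, so
  a total below \<open>1\<close> leaves only empty sets.\<close>

lemma hausdorff_measure_0_eq_0:
  assumes "hausdorff_measure 0 A = 0"
  shows "A = {}"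
proof -
  have "hausdorff_premeasure 0 1 A < 1"
    using hausdorff_premeasure_eq_0_of_measure[OF assms] by simp
  then obtain U where U: "A \<subseteq> (\<Union>i. U i)" "(\<Sum>i. hausdorff_gauge 0 (U i)) < 1"
    by (auto simp: hausdorff_premeasure_def INF_less_iff)
  have "U i = {}" for i
    using ennreal_suminf_lessD[OF U(2), of i] by (auto simp: hausdorff_gauge_def split: if_splits)
  then show ?thesis using U(1) by simp
qed

text \<open>A cover of total cost below \<open>\<delta> powr s\<close> has all its diameters below
  \<open>\<delta>\<close>. Cheap covers thus meet the diameter restriction automatically.\<close>

lemma hausdorff_measure_eq_0_iff_content:
  assumes s: "0 < s"
  shows "hausdorff_measure s A = 0 \<longleftrightarrow> hausdorff_content s A = 0"
proof
  assume *: "hausdorff_measure s A = 0"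
  have "hausdorff_content s A \<le> hausdorff_premeasure s 1 A"
    unfolding hausdorff_content_def hausdorff_premeasure_def hausdorff_gauge_pos[OF s]
    by (intro INF_superset_mono) auto
  then show "hausdorff_content s A = 0"
    using hausdorff_premeasure_eq_0_of_measure[OF *] by simp
next
  assume *: "hausdorff_content s A = 0"
  have "hausdorff_premeasure s \<delta> A = 0" if \<delta>: "0 < \<delta>" for \<delta>
  proof -
    have "hausdorff_premeasure s \<delta> A \<le> 0"
    proof (rule ennreal_le_epsilon)
      fix e :: real assume e: "0 < e"
      define e' where "e' = min e (\<delta> powr s)"
      have "0 < e'" using e \<delta> by (simp add: e'_def)
      then have "hausdorff_content s A < ennreal e'" by (simp only: * ennreal_less_zero_iff)
      then obtain U where U: "A \<subseteq> (\<Union>i. U i)" "\<And>i. bounded (U i)"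
        "(\<Sum>i. ennreal (diameter (U i) powr s)) < ennreal e'"
        by (rule hausdorff_content_lessE) blast
      have "diameter (U i) \<le> \<delta>" for i
      proof (rule ccontr)
        assume "\<not> diameter (U i) \<le> \<delta>"
        then have "\<delta> powr s \<le> diameter (U i) powr s"
          using \<delta> s by (intro powr_mono2) auto
        moreover have "diameter (U i) powr s < e'"
          using ennreal_suminf_lessD[OF U(3), of i] by (simp add: ennreal_less_iff)
        ultimately show False by (simp add: e'_def)
      qed
      then have "hausdorff_premeasure s \<delta> A \<le> (\<Sum>i. hausdorff_gauge s (U i))"
        unfolding hausdorff_premeasure_def using U by (intro INF_lower) auto
      also have "\<dots> \<le> ennreal e'"
        using U(3) by (simp add: hausdorff_gauge_pos[OF s])
      also have "\<dots> \<le> 0 + ennreal e"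
        by (simp add: e'_def ennreal_leI)
      finally show "hausdorff_premeasure s \<delta> A \<le> 0 + ennreal e" .
    qed
    then show ?thesis by simp
  qed
  then show "hausdorff_measure s A = 0"
    by (simp add: hausdorff_measure_def)
qed

section \<open>Arbitrary norms and their equivalence with the Euclidean norm\<close>

lemma is_norm_nonneg: "is_norm N \<Longrightarrow> 0 \<le> N v"
  and is_norm_eq_0_iff: "is_norm N \<Longrightarrow> N v = 0 \<longleftrightarrow> v = 0"
  and is_norm_scaleR: "is_norm N \<Longrightarrow> N (c *\<^sub>R v) = \<bar>c\<bar> * N v"
  and is_norm_triangle: "is_norm N \<Longrightarrow> N (v + w) \<le> N v + N w"
  unfolding is_norm_def by blast+

lemma is_norm_zero: "is_norm N \<Longrightarrow> N 0 = 0"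
  by (simp add: is_norm_eq_0_iff)

lemma is_norm_minus_commute:
  assumes "is_norm N"
  shows "N (v - w) = N (w - v)"
  using is_norm_scaleR[OF assms, of "-1" "v - w"] by simp

lemma is_norm_triangle_abs_diff:
  assumes "is_norm N"
  shows "\<bar>N v - N w\<bar> \<le> N (v - w)"
  using is_norm_triangle[OF assms, of w "v - w"] is_norm_triangle[OF assms, of v "w - v"]
    is_norm_minus_commute[OF assms, of v w] by simp

lemma is_norm_sum_le:
  assumes "is_norm N" "finite A"
  shows "N (\<Sum>i\<in>A. f i) \<le> (\<Sum>i\<in>A. N (f i))"
  using assms(2)
proof (induction rule: finite_induct)
  case empty
  then show ?case by (simp add: is_norm_zero[OF assms(1)])
next
  case (insert i A)
  then show ?case
    using is_norm_triangle[OF assms(1), of "f i" "\<Sum>i\<in>A. f i"] by simp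
qed

lemma is_norm_upper_bound:
  fixes N :: "'a::euclidean_space \<Rightarrow> real"
  assumes N: "is_norm N"
  obtains B where "0 < B" "\<And>v. N v \<le> B * norm v"
proof
  \<comment> \<open>Each coordinate is at most \<open>norm v\<close> in absolute value, so the sum
    of the \<open>N b\<close> suffices as a factor; the added \<open>1\<close> makes positivity
    immediate.\<close>
  define B where "B = (\<Sum>b\<in>Basis. N b) + 1"
  have B: "0 \<le> (\<Sum>b\<in>Basis. N b)" by (intro sum_nonneg is_norm_nonneg[OF N])
  then show "0 < B" by (simp add: B_def)
  fix v :: 'a
  have "N v = N (\<Sum>b\<in>Basis. (v \<bullet> b) *\<^sub>R b)" by (simp add: euclidean_representation)
  also have "\<dots> \<le> (\<Sum>b\<in>Basis. \<bar>v \<bullet> b\<bar> * N b)"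
    using is_norm_sum_le[OF N, of Basis "\<lambda>b. (v \<bullet> b) *\<^sub>R b"] by (simp add: is_norm_scaleR[OF N])
  also have "\<dots> \<le> (\<Sum>b\<in>Basis. norm v * N b)"
    by (intro sum_mono mult_right_mono Basis_le_norm is_norm_nonneg[OF N])
  also have "\<dots> \<le> B * norm v"
    by (simp add: B_def algebra_simps sum_distrib_left)
  finally show "N v \<le> B * norm v" .
qed

text \<open>The continuous function \<open>N\<close> attains its minimum on the compact unit sphere.
  The minimum is positive because \<open>N\<close> vanishes only at \<open>0\<close>, and
  homogeneity extends the bound to all vectors.\<close>

lemma is_norm_lower_bound:
  fixes N :: "'a::euclidean_space \<Rightarrow> real"
  assumes N: "is_norm N"
  obtains c where "0 < c" "\<And>v. c * norm v \<le> N v"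
proof -
  obtain B where B: "0 < B" "\<And>v. N v \<le> B * norm v" using is_norm_upper_bound[OF N] by blast
  have "continuous_on UNIV N"
  proof (rule lipschitz_on_continuous_on)
    show "B-lipschitz_on UNIV N"
      using B is_norm_triangle_abs_diff[OF N]
      by (intro lipschitz_onI) (auto simp: dist_norm intro: order_trans)
  qed
  then have "continuous_on (sphere 0 1) N" by (rule continuous_on_subset) simp
  moreover have "sphere (0::'a) 1 \<noteq> {}" by simp
  ultimately obtain w where w: "w \<in> sphere 0 1" "\<And>v. v \<in> sphere 0 1 \<Longrightarrow> N w \<le> N v"
    using continuous_attains_inf[of "sphere (0::'a) 1" N] by auto
  show thesis
  proof
    show "0 < N w"
      using w(1) is_norm_nonneg[OF N, of w] is_norm_eq_0_iff[OF N, of w]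
      by (metis dist_0_norm mem_sphere norm_zero order_le_less zero_neq_one)
    fix v :: 'a
    show "N w * norm v \<le> N v"
    proof (cases "v = 0")
      case False
      then have "N w \<le> N ((1 / norm v) *\<^sub>R v)" by (intro w(2)) simp
      then show ?thesis
        using False by (simp add: is_norm_scaleR[OF N] field_simps)
    qed (simp add: is_norm_zero[OF N])
  qed
qed

section \<open>Polar coordinates over the faces of a cube\<close>

text \<open>The difference splits into \<open>(u - v) / N u\<close> and a multiple of
  \<open>v\<close> that corrects the normalising factor; by the reverse triangle inequality each has
  norm at most \<open>N (u - v) / N u\<close>.\<close>

lemma is_norm_normalize_diff_le:
  assumes N: "is_norm N" and "u \<noteq> 0" "v \<noteq> 0"
  shows "N ((1 / N u) *\<^sub>R u - (1 / N v) *\<^sub>R v) \<le> 2 * N (u - v) / N u"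
proof -
  have pos: "0 < N u" "0 < N v"
    using assms is_norm_nonneg[OF N] is_norm_eq_0_iff[OF N] by (metis order_le_less)+
  have "(1 / N u) *\<^sub>R u - (1 / N v) *\<^sub>R v = (1 / N u) *\<^sub>R (u - v) + (1 / N u - 1 / N v) *\<^sub>R v"
    by (simp add: algebra_simps)
  then have "N ((1 / N u) *\<^sub>R u - (1 / N v) *\<^sub>R v) \<le> N (u - v) / N u + \<bar>1 / N u - 1 / N v\<bar> * N v"
    using is_norm_triangle[OF N, of "(1 / N u) *\<^sub>R (u - v)" "(1 / N u - 1 / N v) *\<^sub>R v"] pos
    by (simp add: is_norm_scaleR[OF N])
  also have "1 / N u - 1 / N v = (N v - N u) / (N u * N v)"
    using pos by (simp add: field_simps)
  also have "\<bar>(N v - N u) / (N u * N v)\<bar> * N v = \<bar>N v - N u\<bar> / N u"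
    using pos by (simp add: abs_mult)
  also have "\<dots> \<le> N (u - v) / N u"
    using pos is_norm_triangle_abs_diff[OF N, of u v]
    by (intro divide_right_mono) (auto simp: abs_minus_commute)
  finally show ?thesis by simp
qed

text \<open>The passage from one point to the other is a change of signed radius along
  \<open>u\<close>, of length \<open>\<bar>a - b\<bar>\<close>, followed by a change of direction at
  radius \<open>b\<close>.\<close>

lemma is_norm_polar_diff_le:
  assumes N: "is_norm N" and "u \<noteq> 0" "v \<noteq> 0"
  shows "N ((a / N u) *\<^sub>R u - (b / N v) *\<^sub>R v) \<le> \<bar>a - b\<bar> + \<bar>b\<bar> * (2 * N (u - v) / N u)"
proof -
  have pos: "0 < N u"
    using assms is_norm_nonneg[OF N] is_norm_eq_0_iff[OF N] by (metis order_le_less)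
  have "(a / N u) *\<^sub>R u - (b / N v) *\<^sub>R v =
      ((a - b) / N u) *\<^sub>R u + b *\<^sub>R ((1 / N u) *\<^sub>R u - (1 / N v) *\<^sub>R v)"
    by (simp add: algebra_simps diff_divide_distrib)
  then have "N ((a / N u) *\<^sub>R u - (b / N v) *\<^sub>R v) \<le>
      \<bar>a - b\<bar> + \<bar>b\<bar> * N ((1 / N u) *\<^sub>R u - (1 / N v) *\<^sub>R v)"
    using is_norm_triangle[OF N, of "((a - b) / N u) *\<^sub>R u" "b *\<^sub>R ((1 / N u) *\<^sub>R u - (1 / N v) *\<^sub>R v)"] pos
    by (simp add: is_norm_scaleR[OF N])
  also have "\<dots> \<le> \<bar>a - b\<bar> + \<bar>b\<bar> * (2 * N (u - v) / N u)"
    using is_norm_normalize_diff_le[OF assms] by (intro add_left_mono mult_left_mono) auto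
  finally show ?thesis .
qed

text \<open>Dividing \<open>w\<close> by a coordinate of largest absolute value puts it on the face
  \<open>u $ i = 1\<close> of the cube \<open>[-1, 1]^n\<close>. The sign of that coordinate, kept
  in \<open>\<sigma>\<close>, tells this face from the opposite one.\<close>

lemma is_norm_polar_face:
  fixes N :: "real ^ 'n \<Rightarrow> real"
  assumes N: "is_norm N"
  obtains i \<sigma> u where "\<sigma> \<in> {1, -1}" "u $ i = 1" "\<And>j. \<bar>u $ j\<bar> \<le> 1"
    "w = (\<sigma> * N w / N u) *\<^sub>R u"
proof (cases "w = 0")
  case True
  show thesis
    by (rule that[of 1 "vec 1"]) (auto simp: True is_norm_zero[OF N])
next
  case False
  define m where "m = Max (range (\<lambda>j. \<bar>w $ j\<bar>))"
  have "m \<in> range (\<lambda>j. \<bar>w $ j\<bar>)" unfolding m_def by (intro Max_in) auto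
  then obtain i where i: "m = \<bar>w $ i\<bar>" by auto
  have le: "\<bar>w $ j\<bar> \<le> \<bar>w $ i\<bar>" for j
    unfolding i[symmetric] m_def by (intro Max_ge) auto
  have wi: "w $ i \<noteq> 0"
  proof
    assume "w $ i = 0"
    then have "w $ j = 0" for j using le[of j] by simp
    then show False using False by (simp add: vec_eq_iff)
  qed
  have Nw: "N w \<noteq> 0" using False by (simp add: is_norm_eq_0_iff[OF N])
  define u where "u = (1 / w $ i) *\<^sub>R w"
  show thesis
  proof (rule that[of "sgn (w $ i)" u i])
    show "sgn (w $ i) \<in> {1, -1}" using wi by (auto simp: sgn_if)
    show "u $ i = 1" using wi by (simp add: u_def)
    show "\<bar>u $ j\<bar> \<le> 1" for j using wi le[of j] by (simp add: u_def abs_mult divide_simps)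
    have "N u = N w / \<bar>w $ i\<bar>" by (simp add: u_def is_norm_scaleR[OF N])
    then have "sgn (w $ i) * N w / N u = w $ i" using wi Nw by (simp add: sgn_mult_abs)
    then show "w = (sgn (w $ i) * N w / N u) *\<^sub>R u" using wi by (simp add: u_def)
  qed
qed

section \<open>Covering an annulus by small cells\<close>

text \<open>\<open>C\<close> is uniform in \<open>U\<close> and \<open>r\<close> but depends on
  \<open>M\<close>: at radius \<open>\<rho>\<close> a change of direction moves a point in
  proportion to \<open>\<rho>\<close>.\<close>

lemma hausdorff_content_annulus:
  fixes N :: "real ^ 'n \<Rightarrow> real" and x :: "real ^ 'n"
  assumes N: "is_norm N" and s: "0 < s" and M: "0 \<le> M"
  obtains C where "0 \<le> C"
    "\<And>U r. \<lbrakk>U \<subseteq> {0..M}; diameter U \<le> r; 0 < r; r \<le> 1\<rbrakk> \<Longrightarrow>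
       hausdorff_content (s + (real CARD('n) - 1)) {y. N (x - y) \<in> U} \<le> ennreal (C * r powr s)"
proof -
  obtain B where B: "0 < B" "\<And>v. N v \<le> B * norm v" using is_norm_upper_bound[OF N] by blast
  obtain c where c: "0 < c" "\<And>v. c * norm v \<le> N v" using is_norm_lower_bound[OF N] by blast
  define d where "d = CARD('n)"
  have d: "1 \<le> d" by (simp add: d_def Suc_le_eq)
  define t where "t = s + (real d - 1)"
  have t: "0 < t" using s d by (simp add: t_def)
  \<comment> \<open>Inside a cell the radius varies by \<open>r\<close>, and the direction
    contributes at most \<open>M * (2 * (2 * B * d * r) / c)\<close>; the outer division by
    \<open>c\<close> turns \<open>N\<close> back into Euclidean distance.\<close>
  define K where "K = (1 + 4 * M * B * d / c) / c"
  have K: "0 < K" using M B c by (auto simp: K_def intro!: divide_pos_pos add_pos_nonneg)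
  \<comment> \<open>There are \<open>2 * d\<close> signed faces with at most
    \<open>(5 / r) ^ (d - 1)\<close> grid cells each, and \<open>K powr t\<close> comes from the
    cell diameters.\<close>
  define C where "C = 2 * d * 5 ^ (d - 1) * K powr t"
  show thesis
  proof (rule that[of C])
    show "0 \<le> C" by (simp add: C_def)
    fix U :: "real set" and r :: real
    assume U: "U \<subseteq> {0..M}" "diameter U \<le> r" and r: "0 < r" "r \<le> 1"
    define k where "k = nat \<lceil>1 / r\<rceil>"
    have k: "1 / r \<le> real k" "real k \<le> 1 / r + 1"
      using r unfolding k_def by (simp_all add: of_nat_ceiling of_nat_nat)
    \<comment> \<open>Indices of a grid of mesh \<open>r\<close> on the \<open>d - 1\<close> free
      coordinates of the face; \<open>k\<close> is large enough for
      \<open>\<lfloor>u $ j / r\<rfloor>\<close> to stay in range when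
      \<open>\<bar>u $ j\<bar> \<le> 1\<close>. Extensional functions keep the index set
      finite.\<close>
    define G where "G i = (UNIV - {i}) \<rightarrow>\<^sub>E {- int k..int k}" for i :: 'n
    define I where "I = (SIGMA i:UNIV. {1, -1 :: real} \<times> G i)"
    \<comment> \<open>A cell is parametrised by radius and face point, the form in which
      \<open>is_norm_polar_diff_le\<close> compares two of its points.\<close>
    define cell where "cell = (\<lambda>(i, \<sigma>, g). {x - (\<sigma> * \<rho> / N u) *\<^sub>R u | \<rho> u. \<rho> \<in> U \<and> u $ i = 1 \<and>
        (\<forall>j. j \<noteq> i \<longrightarrow> \<bar>u $ j - r * of_int (g j)\<bar> \<le> r)})"
    have finG: "finite (G i)" for i by (simp add: G_def finite_PiE)
    have cardG: "card (G i) = (2 * k + 1) ^ (d - 1)" for i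
      by (simp add: G_def card_PiE card_Diff_subset d_def nat_add_distrib nat_mult_distrib)
    have finI: "finite I" by (auto simp: I_def finG)
    have cardI: "card I = d * (2 * (2 * k + 1) ^ (d - 1))"
      by (simp add: I_def card_SigmaI finG card_cartesian_product cardG d_def)
    have cover: "{y. N (x - y) \<in> U} \<subseteq> (\<Union>p\<in>I. cell p)"
    proof
      fix y assume "y \<in> {y. N (x - y) \<in> U}"
      then have yU: "N (x - y) \<in> U" by simp
      obtain i \<sigma> u where u: "\<sigma> \<in> {1, -1 :: real}" "u $ i = 1" "\<And>j. \<bar>u $ j\<bar> \<le> 1"
        "x - y = (\<sigma> * N (x - y) / N u) *\<^sub>R u"
        by (rule is_norm_polar_face[OF N, where w = "x - y"]) blast
      define g where "g = restrict (\<lambda>j. \<lfloor>u $ j / r\<rfloor>) (UNIV - {i})"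
      have "\<lfloor>u $ j / r\<rfloor> \<in> {- int k..int k}" for j
      proof -
        have "\<bar>u $ j / r\<bar> \<le> real k"
          using u(3)[of j] r k(1) by (simp add: divide_simps)
        then have "- real k \<le> u $ j / r" "u $ j / r \<le> real k" by linarith+
        then show ?thesis by (simp add: le_floor_iff floor_le_iff)
      qed
      then have "g \<in> G i" unfolding g_def G_def by (intro restrict_PiE_iff[THEN iffD2]) auto
      then have "(i, \<sigma>, g) \<in> I" using u(1) by (simp add: I_def)
      moreover have "y \<in> cell (i, \<sigma>, g)"
      proof -
        have "\<bar>u $ j - r * of_int (g j)\<bar> \<le> r" if "j \<noteq> i" for j
        proof -
          have "\<bar>u $ j / r - of_int \<lfloor>u $ j / r\<rfloor>\<bar> \<le> 1" by linarith
          then have "r * \<bar>u $ j / r - of_int \<lfloor>u $ j / r\<rfloor>\<bar> \<le> r * 1"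
            using r by (intro mult_left_mono) auto
          also have "r * \<bar>u $ j / r - of_int \<lfloor>u $ j / r\<rfloor>\<bar> = \<bar>r * (u $ j / r - of_int \<lfloor>u $ j / r\<rfloor>)\<bar>"
            using r by (simp add: abs_mult)
          finally show ?thesis
            using r that by (simp add: g_def right_diff_distrib)
        qed
        moreover have "y = x - (\<sigma> * N (x - y) / N u) *\<^sub>R u"
          using u(4) by (simp add: algebra_simps)
        ultimately show ?thesis
          using yU u(2) unfolding cell_def by blast
      qed
      ultimately show "y \<in> (\<Union>p\<in>I. cell p)" by blast
    qed
    have dist_cell: "dist y z \<le> K * r" if pI: "p \<in> I" and yp: "y \<in> cell p" and zp: "z \<in> cell p" for p y z
    proof -
      obtain i \<sigma> g where p: "p = (i, \<sigma>, g)" by (cases p)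
      have \<sigma>: "\<bar>\<sigma>\<bar> = 1" using pI by (auto simp: p I_def)
      obtain \<rho> u where y: "y = x - (\<sigma> * \<rho> / N u) *\<^sub>R u" "\<rho> \<in> U" "u $ i = 1"
        "\<And>j. j \<noteq> i \<Longrightarrow> \<bar>u $ j - r * of_int (g j)\<bar> \<le> r"
        using yp by (auto simp: p cell_def)
      obtain \<rho>' v where z: "z = x - (\<sigma> * \<rho>' / N v) *\<^sub>R v" "\<rho>' \<in> U" "v $ i = 1"
        "\<And>j. j \<noteq> i \<Longrightarrow> \<bar>v $ j - r * of_int (g j)\<bar> \<le> r"
        using zp by (auto simp: p cell_def)
      have uv0: "u \<noteq> 0" "v \<noteq> 0" using y(3) z(3) by auto
      \<comment> \<open>The face coordinate \<open>u $ i = 1\<close> forces \<open>norm u\<close> to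
        be at least \<open>1\<close>, which keeps the denominator \<open>N u\<close> away from
        zero.\<close>
      have Nu: "c \<le> N u"
      proof -
        have "c * 1 \<le> c * norm u"
          using component_le_norm_cart[of u i] y(3) c(1) by (intro mult_left_mono) auto
        then show ?thesis using c(2)[of u] by simp
      qed
      \<comment> \<open>Both coordinates lie within \<open>r\<close> of the same grid value, and
        they coincide at \<open>j = i\<close>.\<close>
      have "\<bar>(u - v) $ j\<bar> \<le> 2 * r" for j
        using y(3) z(3) y(4)[of j] z(4)[of j] r by (cases "j = i") auto
      then have "norm (u - v) \<le> (\<Sum>j\<in>(UNIV :: 'n set). 2 * r)"
        by (intro order_trans[OF norm_le_l1_cart] sum_mono)
      then have "B * norm (u - v) \<le> B * (d * (2 * r))"
        using B(1) by (intro mult_left_mono) (auto simp: d_def)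
      then have Nuv: "N (u - v) \<le> 2 * B * d * r" using B(2)[of "u - v"] by simp
      have "bounded U" using U(1) bounded_closed_interval bounded_subset by blast
      then have "\<bar>\<rho> - \<rho>'\<bar> \<le> r"
        using diameter_bounded_bound[of U \<rho> \<rho>'] y(2) z(2) U(2) by (simp add: dist_real_def)
      then have \<rho>: "\<bar>\<sigma> * \<rho> - \<sigma> * \<rho>'\<bar> \<le> r"
        using \<sigma> by (simp flip: right_diff_distrib add: abs_mult)
      have \<rho>': "\<bar>\<sigma> * \<rho>'\<bar> \<le> M" using z(2) U(1) \<sigma> by (auto simp: abs_mult)
      have "dist y z = norm ((\<sigma> * \<rho> / N u) *\<^sub>R u - (\<sigma> * \<rho>' / N v) *\<^sub>R v)"
        by (simp add: y(1) z(1) dist_norm norm_minus_commute)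
      then have "c * dist y z \<le> N ((\<sigma> * \<rho> / N u) *\<^sub>R u - (\<sigma> * \<rho>' / N v) *\<^sub>R v)"
        using c(2) by simp
      also have "\<dots> \<le> \<bar>\<sigma> * \<rho> - \<sigma> * \<rho>'\<bar> + \<bar>\<sigma> * \<rho>'\<bar> * (2 * N (u - v) / N u)"
        by (rule is_norm_polar_diff_le[OF N uv0])
      also have "\<dots> \<le> r + M * (2 * (2 * B * d * r) / c)"
      proof (rule add_mono[OF \<rho> mult_mono[OF \<rho>' _ M]])
        have "0 \<le> 2 * N (u - v)" using is_norm_nonneg[OF N] by simp
        then show "2 * N (u - v) / N u \<le> 2 * (2 * B * d * r) / c" "0 \<le> 2 * N (u - v) / N u"
          using Nuv Nu c(1) by (intro frac_le divide_nonneg_nonneg; linarith)+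
      qed
      also have "\<dots> = c * (K * r)"
        using c(1) by (simp add: K_def field_simps)
      finally show ?thesis using c(1) by simp
    qed
    have "hausdorff_content t {y. N (x - y) \<in> U} \<le> ennreal (card I * (K * r) powr t)"
    proof (rule hausdorff_content_finite_cover[OF finI cover _ _ t])
      fix p assume p: "p \<in> I"
      show "bounded (cell p)"
        unfolding bounded_two_points using dist_cell[OF p] by blast
      show "diameter (cell p) \<le> K * r"
        using dist_cell[OF p] K r by (intro diameter_le) (auto simp: dist_norm)
    qed
    also have "card I * (K * r) powr t \<le> C * r powr s"
    proof -
      \<comment> \<open>The exponent \<open>t = s + (d - 1)\<close> yields a factor
        \<open>r ^ (d - 1)\<close>, which cancels the growth of the number of cells.\<close>
      have Kr: "(K * r) powr t = K powr t * (r powr s * r ^ (d - 1))"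
        using K r d by (simp add: powr_mult t_def powr_add of_nat_diff flip: powr_realpow)
      \<comment> \<open>From \<open>k \<le> 1 / r + 1\<close> one gets \<open>2 / r + 3\<close>, and
        \<open>3 \<le> 3 / r\<close> because \<open>r \<le> 1\<close>.\<close>
      have "real (2 * k + 1) \<le> 5 / r"
        using k(2) r by (simp add: field_simps)
      then have "real (2 * k + 1) ^ (d - 1) \<le> (5 / r) ^ (d - 1)"
        by (intro power_mono) auto
      then have "real (card I) \<le> d * (2 * (5 / r) ^ (d - 1))"
        unfolding cardI by (simp add: mult_left_mono)
      then have "card I * (K * r) powr t \<le> d * (2 * (5 / r) ^ (d - 1)) * (K * r) powr t"
        by (intro mult_right_mono) auto
      also have "\<dots> = C * r powr s"
        using r unfolding Kr by (simp add: C_def power_divide)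
      finally show ?thesis .
    qed
    finally show "hausdorff_content (s + (real CARD('n) - 1)) {y. N (x - y) \<in> U} \<le> ennreal (C * r powr s)"
      by (simp add: t_def d_def ennreal_leI)
  qed
qed

section \<open>Transfer of null content from the pinned distance set to the set\<close>

text \<open>Pulling a cover of the distances back to annuli multiplies its cost by at most the
  annulus constant, which is available once distances are bounded by \<open>M\<close>.\<close>

lemma hausdorff_content_eq_0_of_pinned_bounded:
  fixes N :: "real ^ 'n \<Rightarrow> real" and x :: "real ^ 'n"
  assumes N: "is_norm N" and s: "0 < s" and M: "0 \<le> M"
    and null: "hausdorff_content s (pinned_distance_set N x E) = 0"
  shows "hausdorff_content (s + (real CARD('n) - 1)) {y \<in> E. N (x - y) \<le> M} = 0"
proof -
  define t where "t = s + (real CARD('n) - 1)"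
  obtain C where C: "0 \<le> C"
    "\<And>U r. \<lbrakk>U \<subseteq> {0..M}; diameter U \<le> r; 0 < r; r \<le> 1\<rbrakk> \<Longrightarrow>
       hausdorff_content t {y. N (x - y) \<in> U} \<le> ennreal (C * r powr s)"
    using hausdorff_content_annulus[OF N s M, of x] unfolding t_def by blast
  have "hausdorff_content t {y \<in> E. N (x - y) \<le> M} \<le> 0"
  proof (rule ennreal_le_epsilon)
    fix e :: real assume e: "0 < e"
    \<comment> \<open>The bound \<open>1/2\<close> gives \<open>q i \<le> 1\<close>, as both
      summands of \<open>q i\<close> are at most \<open>e'\<close>. The other bound makes the final
      total \<open>C * (e' + e')\<close> at most \<open>e\<close>, with \<open>C + 1\<close> in
      place of \<open>C\<close> to allow \<open>C = 0\<close>.\<close>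
    define e' where "e' = min (1/2) (e / (2 * (C + 1)))"
    have e': "0 < e'" "e' \<le> 1/2"
      using e C(1) by (simp_all only: e'_def min_less_iff_conj min.cobounded1) simp
    have "e' \<le> e / (2 * (C + 1))" by (simp add: e'_def)
    then have "e' * (2 * (C + 1)) \<le> e"
      using C(1) by (subst (asm) pos_le_divide_eq) auto
    then have eC: "C * (e' + e') \<le> e" using e'(1) by (simp add: algebra_simps)
    have "hausdorff_content s (pinned_distance_set N x E) < ennreal e'"
      using e'(1) by (simp only: null ennreal_less_zero_iff)
    then obtain V where V: "pinned_distance_set N x E \<subseteq> (\<Union>i. V i)" "\<And>i. bounded (V i)"
      "(\<Sum>i. ennreal (diameter (V i) powr s)) < ennreal e'"
      by (rule hausdorff_content_lessE) blast
    \<comment> \<open>The extra summand keeps \<open>r i\<close> positive when \<open>V i\<close> has diameter zero.\<close>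
    define q where "q i = diameter (V i) powr s + e' * (1/2) ^ Suc i" for i
    define r where "r i = q i powr (1 / s)" for i
    have q: "0 < q i" "q i \<le> 1" "diameter (V i) powr s \<le> q i" for i
    proof -
      show "0 < q i" "diameter (V i) powr s \<le> q i"
        using e' by (simp_all add: q_def add_nonneg_pos)
      have "diameter (V i) powr s < e'"
        using ennreal_suminf_lessD[OF V(3), of i] by (simp add: ennreal_less_iff)
      moreover have "e' * (1/2) ^ Suc i \<le> e' * 1"
        using e' by (intro mult_left_mono power_le_one) auto
      ultimately show "q i \<le> 1" using e'(2) by (simp add: q_def)
    qed
    have r: "0 < r i" "r i \<le> 1" "r i powr s = q i" for i
      using q[of i] s by (auto simp: r_def powr_powr intro!: powr_le1)
    \<comment> \<open>Truncation to \<open>{0..M}\<close> makes the annulus estimate applicable and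
      does not increase diameters.\<close>
    have diam: "diameter (V i \<inter> {0..M}) \<le> r i" for i
    proof -
      have "diameter (V i \<inter> {0..M}) \<le> diameter (V i)"
        by (intro diameter_subset V) auto
      also have "\<dots> = (diameter (V i) powr s) powr (1 / s)"
        using s diameter_ge_0[OF V(2)] by (simp add: powr_powr)
      also have "\<dots> \<le> r i"
        using s q(3) by (auto simp: r_def intro!: powr_mono2)
      finally show ?thesis .
    qed
    have "{y \<in> E. N (x - y) \<le> M} \<subseteq> (\<Union>i. {y. N (x - y) \<in> V i \<inter> {0..M}})"
      using V(1) is_norm_nonneg[OF N] by (fastforce simp: pinned_distance_set_def)
    then have "hausdorff_content t {y \<in> E. N (x - y) \<le> M} \<le>
        (\<Sum>i. hausdorff_content t {y. N (x - y) \<in> V i \<inter> {0..M}})"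
      by (rule order_trans[OF hausdorff_content_mono hausdorff_content_subadditive])
    also have "\<dots> \<le> (\<Sum>i. ennreal C * (ennreal (diameter (V i) powr s) + ennreal (e' * (1/2) ^ Suc i)))"
    proof (intro suminf_le summableI)
      fix i
      have "hausdorff_content t {y. N (x - y) \<in> V i \<inter> {0..M}} \<le> ennreal (C * q i)"
        using C(2)[OF _ diam[of i] r(1,2)] by (simp add: r(3))
      also have "\<dots> = ennreal C * (ennreal (diameter (V i) powr s) + ennreal (e' * (1/2) ^ Suc i))"
        using C(1) e'(1) by (simp add: q_def ennreal_mult ennreal_plus[symmetric] del: ennreal_plus)
      finally show "hausdorff_content t {y. N (x - y) \<in> V i \<inter> {0..M}} \<le>
        ennreal C * (ennreal (diameter (V i) powr s) + ennreal (e' * (1/2) ^ Suc i))" .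
    qed
    also have "\<dots> = ennreal C * ((\<Sum>i. ennreal (diameter (V i) powr s)) + (\<Sum>i. ennreal (e' * (1/2) ^ Suc i)))"
      by (subst ennreal_suminf_cmult, subst suminf_add[OF summableI summableI]) simp
    also have "(\<Sum>i. ennreal (e' * (1/2) ^ Suc i)) = ennreal e'"
      using e'(1) by (intro suminf_half_series_ennreal_mult less_imp_le)
    also have "ennreal C * ((\<Sum>i. ennreal (diameter (V i) powr s)) + ennreal e')
        \<le> ennreal C * (ennreal e' + ennreal e')"
      by (intro mult_left_mono add_right_mono less_imp_le[OF V(3)]) simp
    also have "\<dots> = ennreal (C * (e' + e'))"
      using ennreal_mult'[OF C(1)] ennreal_plus[of e' e'] e'(1) by simp
    also have "\<dots> \<le> 0 + ennreal e" using eC by (simp add: ennreal_leI)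
    finally show "hausdorff_content t {y \<in> E. N (x - y) \<le> M} \<le> 0 + ennreal e" .
  qed
  then show ?thesis by (simp add: t_def)
qed

text \<open>\<open>E\<close> is the union of its parts within integer distance of \<open>x\<close>.
  Each part is null, whatever the growth of the annulus constants, so countable subadditivity
  suffices.\<close>

lemma hausdorff_content_eq_0_of_pinned:
  fixes N :: "real ^ 'n \<Rightarrow> real" and x :: "real ^ 'n"
  assumes N: "is_norm N" and s: "0 < s"
    and null: "hausdorff_content s (pinned_distance_set N x E) = 0"
  shows "hausdorff_content (s + (real CARD('n) - 1)) E = 0"
proof -
  have "E \<subseteq> (\<Union>m. {y \<in> E. N (x - y) \<le> real m})"
    using real_arch_simple by blast
  then have "hausdorff_content (s + (real CARD('n) - 1)) E \<le>
      (\<Sum>m. hausdorff_content (s + (real CARD('n) - 1)) {y \<in> E. N (x - y) \<le> real m})"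
    by (rule order_trans[OF hausdorff_content_mono hausdorff_content_subadditive])
  then show ?thesis
    by (simp add: hausdorff_content_eq_0_of_pinned_bounded[OF N s _ null])
qed

section \<open>Hausdorff dimension\<close>

lemma hausdorff_dim_le: "0 \<le> s \<Longrightarrow> hausdorff_measure s A = 0 \<Longrightarrow> hausdorff_dim A \<le> ereal s"
  unfolding hausdorff_dim_def by (intro Inf_lower) blast

lemma hausdorff_dim_empty_le: "0 \<le> s \<Longrightarrow> hausdorff_dim {} \<le> ereal s"
proof (rule hausdorff_dim_le)
  have "hausdorff_premeasure s \<delta> ({} :: 'a set) \<le> (\<Sum>i::nat. hausdorff_gauge s ({} :: 'a set))" if "0 < \<delta>" for \<delta>
    unfolding hausdorff_premeasure_def using that
    by (intro INF_lower) auto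
  then show "hausdorff_measure s ({} :: 'a set) = 0"
    by (simp add: hausdorff_measure_def hausdorff_gauge_def)
qed

lemma hausdorff_dim_le_of_pinned_null:
  fixes N :: "real ^ 'n \<Rightarrow> real" and x :: "real ^ 'n"
  assumes N: "is_norm N" and s: "0 \<le> s"
    and null: "hausdorff_measure s (pinned_distance_set N x E) = 0"
  shows "hausdorff_dim E \<le> ereal (s + (real CARD('n) - 1))"
\<comment> \<open>The content criterion covers only \<open>0 < s\<close>. At \<open>s = 0\<close> a
  null pinned distance set is empty, and then so is \<open>E\<close>.\<close>
proof (cases "s = 0")
  case True
  then have "pinned_distance_set N x E = {}"
    using null hausdorff_measure_0_eq_0 by blast
  then have "E = {}" by (auto simp: pinned_distance_set_def)
  moreover have "0 \<le> s + (real CARD('n) - 1)" using s by (simp add: Suc_le_eq)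
  ultimately show ?thesis by (simp only: hausdorff_dim_empty_le)
next
  case False
  have d: "0 \<le> real CARD('n) - 1" by (simp add: Suc_le_eq)
  have "0 < s" "0 < s + (real CARD('n) - 1)" using False s d by linarith+
  then have "hausdorff_measure (s + (real CARD('n) - 1)) E = 0"
    using null hausdorff_content_eq_0_of_pinned[OF N, of s x E]
    by (simp only: hausdorff_measure_eq_0_iff_content)
  then show ?thesis using s d by (intro hausdorff_dim_le) simp_all
qed

theorem theorem1p2:
  fixes N :: "real ^ 'n \<Rightarrow> real"
    and E :: "(real ^ 'n) set"
    and x :: "real ^ 'n"
  assumes "is_norm N"
  shows "hausdorff_dim (pinned_distance_set N x E)
           \<ge> hausdorff_dim E - ereal (real CARD('n) - 1)"
  unfolding hausdorff_dim_def[of "pinned_distance_set N x E"]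
proof (rule Inf_greatest, clarify)
  fix s :: real
  assume "0 \<le> s" "hausdorff_measure s (pinned_distance_set N x E) = 0"
  from hausdorff_dim_le_of_pinned_null[OF assms this]
  show "hausdorff_dim E - ereal (real CARD('n) - 1) \<le> ereal s"
    by (simp add: ereal_minus_le)
qed

end
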